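(* For a shape $\lambda$ and a pattern $\sigma$, let $\lambda_{sym}(\{\sigma\})$ be the number of symmetric full placements on $\lambda$ which avoid $\sigma$. Let $\alpha$ and $\beta$ be involutions in $\mathcal{S}_j$. If for every self-conjugate shape $\lambda$ we have $\lambda_{sym}(\{\alpha\})=\lambda_{sym}(\{\beta\})$, then the prefixes $\alpha$ and $\beta$ may be exchanged.
   Context: A shape is a Ferrers shape $\lambda=(\lambda_1\ge\lambda_2\ge\cdots\ge\lambda_k>0)$, coordinatized from the bottom left corner: box $(x,y)$ (column $x$ from the left, row $y$ from the bottom) belongs to $\lambda$ iff $1\le y\le k$ and $1\le x\le\lambda_y$. It is self-conjugate if $(x,y)\in\lambda$ iff $(y,x)\in\lambda$. A placement on $\lambda$ is an assignment of dots to some boxes of $\lambda$ such that no row or column contains more than one dot; it is full if each row and each column of $\lambda$ contains exactly one dot. A placement on a self-conjugate shape is symmetric if it has a dot in $(x,y)$ iff it has a dot in $(y,x)$. The pattern of a sequence of $m$ distinct numbers is its order-preserving relabelling by $1,\dots,m$. A placement on $\lambda$ contains $\sigma\in\mathcal{S}_m$ if there are $m$ dots $(x_1,y_1),\dots,(x_m,y_m)$ in the placement with $x_1<\cdots<x_m$, with the pattern of $y_1\ldots y_m$ equal to $\sigma$, and all lying in a rectangular subshape of $\lambda$ (i.e. the box $(\max_i x_i,\max_i y_i)$ lies in $\lambda$). Otherwise it avoids $\sigma$. A permutation $\pi\in\mathcal{S}_n$ avoids $\sigma\in\mathcal{S}_m$ if no subsequence of $\pi_1\ldots\pi_n$ has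 pattern $\sigma$. $\mathcal{I}_n(\sigma)$ is the number of involutions in $\mathcal{S}_n$ (permutations whose square is the identity) which avoid $\sigma$. For $\alpha,\beta\in\mathcal{S}_j$, the prefixes $\alpha$ and $\beta$ may be exchanged if for every $k\ge j$, every ordering $\tau=\tau_{j+1}\ldots\tau_k$ of $\{j+1,\dots,k\}$, and every $n$, $\mathcal{I}_n(\alpha_1\ldots\alpha_j\tau_{j+1}\ldots\tau_k)=\mathcal{I}_n(\beta_1\ldots\beta_j\tau_{j+1}\ldots\tau_k)$. *)

theory Defs
  imports "HOL-Combinatorics.Combinatorics" "HOL-Library.Sublist"
begin

section \<open>Permutations, one-line notation and patterns\<close>

text \<open>
  A permutation in \<open>S\<^sub>n\<close> is a function \<open>\<pi> :: nat \<Rightarrow> nat\<close> with \<open>\<pi> permutes {1..n}\<close>.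
  A pattern is given by its word in one-line notation, so that a prefix is extended by list append.
\<close>

definition one_line :: "nat \<Rightarrow> (nat \<Rightarrow> nat) \<Rightarrow> nat list" where
  "one_line n \<pi> = map \<pi> [1..<Suc n]"

definition involution_on :: "nat \<Rightarrow> (nat \<Rightarrow> nat) \<Rightarrow> bool" where
  "involution_on n \<pi> \<longleftrightarrow> \<pi> permutes {1..n} \<and> \<pi> \<circ> \<pi> = id"

text \<open>Each entry of a sequence of distinct numbers is replaced by its rank.\<close>

definition pattern_of :: "nat list \<Rightarrow> nat list" where
  "pattern_of ys = map (\<lambda>y. card {z \<in> set ys. z \<le> y}) ys"

lemma length_pattern_of [simp]: "length (pattern_of ys) = length ys"
  by (simp add: pattern_of_def)

lemma pattern_of_less_iff:
  assumes "i < length ys" "k < length ys"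
  shows "pattern_of ys ! i < pattern_of ys ! k \<longleftrightarrow> ys ! i < ys ! k"
proof -
  have le: "card {z \<in> set ys. z \<le> a} \<le> card {z \<in> set ys. z \<le> b}" if "a \<le> b" for a b
    using that by (intro card_mono) auto
  have less: "card {z \<in> set ys. z \<le> a} < card {z \<in> set ys. z \<le> b}"
    if "a < b" "b \<in> set ys" for a b
  proof -
    have "b \<in> {z \<in> set ys. z \<le> b}" "b \<notin> {z \<in> set ys. z \<le> a}"
      using that by auto
    moreover have "{z \<in> set ys. z \<le> a} \<subseteq> {z \<in> set ys. z \<le> b}"
      using that by auto
    ultimately show ?thesis
      by (intro psubset_card_mono) (simp, blast)
  qed
  show ?thesis
    using assms le[of "ys ! k" "ys ! i"] less[of "ys ! i" "ys ! k"]
    by (auto simp: pattern_of_def not_less[symmetric])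
qed

lemma pattern_of_in_permutations:
  assumes "distinct ys"
  shows "pattern_of ys \<in> permutations_of_set {1..length ys}"
proof -
  have dist: "distinct (pattern_of ys)"
    unfolding distinct_conv_nth
  proof (intro allI impI)
    fix i k
    assume "i < length (pattern_of ys)" "k < length (pattern_of ys)" "i \<noteq> k"
    then show "pattern_of ys ! i \<noteq> pattern_of ys ! k"
      using pattern_of_less_iff[of i ys k] pattern_of_less_iff[of k ys i] assms
      by (metis length_pattern_of less_irrefl nat_neq_iff nth_eq_iff_index_eq)
  qed
  have sub: "set (pattern_of ys) \<subseteq> {1..length ys}"
  proof
    fix r assume "r \<in> set (pattern_of ys)"
    then obtain y where y: "y \<in> set ys" "r = card {z \<in> set ys. z \<le> y}"
      by (auto simp: pattern_of_def)
    have "card {z \<in> set ys. z \<le> y} \<le> card (set ys)"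
      by (intro card_mono) auto
    moreover have "card {z \<in> set ys. z \<le> y} > 0"
      using y by (auto simp: card_gt_0_iff)
    ultimately show "r \<in> {1..length ys}"
      using y card_length[of ys] by auto
  qed
  have "set (pattern_of ys) = {1..length ys}"
    using sub dist by (intro card_subset_eq) (auto simp: distinct_card)
  with dist show ?thesis
    by (simp add: permutations_of_set_def)
qed

definition perm_avoids :: "nat \<Rightarrow> (nat \<Rightarrow> nat) \<Rightarrow> nat list \<Rightarrow> bool" where
  "perm_avoids n \<pi> \<sigma> \<longleftrightarrow> \<not> (\<exists>ys. subseq ys (one_line n \<pi>) \<and> pattern_of ys = \<sigma>)"

definition num_involutions_avoiding :: "nat \<Rightarrow> nat list \<Rightarrow> nat" where
  "num_involutions_avoiding n \<sigma> = card {\<pi>. involution_on n \<pi> \<and> perm_avoids n \<pi> \<sigma>}"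

definition prefixes_exchangeable :: "nat \<Rightarrow> (nat \<Rightarrow> nat) \<Rightarrow> (nat \<Rightarrow> nat) \<Rightarrow> bool" where
  "prefixes_exchangeable j \<alpha> \<beta> \<longleftrightarrow>
     (\<forall>k\<ge>j. \<forall>\<tau>\<in>permutations_of_set {j+1..k}. \<forall>n.
        num_involutions_avoiding n (one_line j \<alpha> @ \<tau>) =
        num_involutions_avoiding n (one_line j \<beta> @ \<tau>))"

section \<open>Shapes and placements\<close>

definition ferrers_shape :: "nat list \<Rightarrow> bool" where
  "ferrers_shape lam \<longleftrightarrow> sorted_wrt (\<ge>) lam \<and> (\<forall>l\<in>set lam. l > 0)"

text \<open>
  Boxes are pairs (column, row), both counted from 1; row \<open>y\<close> has length \<open>lam ! (y - 1)\<close>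
  because lists are indexed from 0.
\<close>

definition boxes :: "nat list \<Rightarrow> (nat \<times> nat) set" where
  "boxes lam = {(x, y). 1 \<le> y \<and> y \<le> length lam \<and> 1 \<le> x \<and> x \<le> lam ! (y - 1)}"

definition self_conjugate :: "nat list \<Rightarrow> bool" where
  "self_conjugate lam \<longleftrightarrow> (\<forall>x y. (x, y) \<in> boxes lam \<longleftrightarrow> (y, x) \<in> boxes lam)"

definition placement :: "nat list \<Rightarrow> (nat \<times> nat) set \<Rightarrow> bool" where
  "placement lam P \<longleftrightarrow> P \<subseteq> boxes lam \<and>
     (\<forall>x y y'. (x, y) \<in> P \<and> (x, y') \<in> P \<longrightarrow> y = y') \<and>
     (\<forall>x x' y. (x, y) \<in> P \<and> (x', y) \<in> P \<longrightarrow> x = x')"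

definition full_placement :: "nat list \<Rightarrow> (nat \<times> nat) set \<Rightarrow> bool" where
  "full_placement lam P \<longleftrightarrow> placement lam P \<and>
     (\<forall>x \<in> fst ` boxes lam. \<exists>!y. (x, y) \<in> P) \<and>
     (\<forall>y \<in> snd ` boxes lam. \<exists>!x. (x, y) \<in> P)"

definition symmetric_placement :: "(nat \<times> nat) set \<Rightarrow> bool" where
  "symmetric_placement P \<longleftrightarrow> (\<forall>x y. (x, y) \<in> P \<longleftrightarrow> (y, x) \<in> P)"

text \<open>
  The dots are listed from left to right. The guard \<open>ds \<noteq> []\<close> only matters for the empty pattern,
  for which there is no maximal coordinate; every placement contains it.
\<close>

definition placement_contains ::
    "nat list \<Rightarrow> (nat \<times> nat) set \<Rightarrow> nat list \<Rightarrow> bool" where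
  "placement_contains lam P \<sigma> \<longleftrightarrow>
     (\<exists>ds. set ds \<subseteq> P \<and> sorted_wrt (<) (map fst ds) \<and> pattern_of (map snd ds) = \<sigma> \<and>
        (ds \<noteq> [] \<longrightarrow> (Max (fst ` set ds), Max (snd ` set ds)) \<in> boxes lam))"

definition num_symmetric_avoiding :: "nat list \<Rightarrow> nat list \<Rightarrow> nat" where
  "num_symmetric_avoiding lam \<sigma> =
     card {P. full_placement lam P \<and> symmetric_placement P \<and> \<not> placement_contains lam P \<sigma>}"

end

theory Submission
  imports Defs "HOL-Library.Infinite_Set"
begin

text \<open>
  An involution is identified with its graph, a symmetric set of dots in the square \<open>[n]\<^sup>2\<close>. Mark
  the boxes \<open>(x, y)\<close> such that a copy of \<open>\<tau>\<close> lies strictly north-east of \<open>(x, y)\<close> or of \<open>(y, x)\<close>.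
  Reflecting a copy of an involution \<open>\<alpha>\<close> in the diagonal gives another copy of \<open>\<alpha>\<close>, so \<open>\<alpha>\<tau>\<close>
  occurs iff \<open>\<alpha>\<close> occurs south-west of a marked box. A copy of \<open>\<tau>\<close> that is as far north-east as
  possible uses no dot in a marked box, so the marked region is determined by the dots outside it.
  Fix these outer dots; after the rows and columns they occupy are deleted, the region becomes a
  self-conjugate shape, and the remaining dots form an arbitrary symmetric full placement on it.
\<close>

section \<open>Involutions as symmetric sets of dots\<close>

text \<open>An arbitrary index set \<open>A\<close> lets the same notion cover permutations of
  \<open>{1..n}\<close> and symmetric full placements. Symmetry carries single-valuedness from
  columns to rows and makes the range equal to \<open>A\<close>.\<close>

definition involution_graph :: "nat set \<Rightarrow> (nat \<times> nat) set \<Rightarrow> bool" where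
  "involution_graph A G \<longleftrightarrow> sym G \<and> single_valued G \<and> Domain G = A"

definition word_occurs :: "(nat \<times> nat) set \<Rightarrow> nat list \<Rightarrow> bool" where
  "word_occurs G \<sigma> \<longleftrightarrow>
     (\<exists>ds. set ds \<subseteq> G \<and> sorted_wrt (<) (map fst ds) \<and> pattern_of (map snd ds) = \<sigma>)"

text \<open>\<open>r\<close> and \<open>s\<close> list the columns and rows of a copy in increasing
  order. Treating both alike makes reflection in the diagonal an exchange of \<open>r\<close> and
  \<open>s\<close>.\<close>

definition occurs_within ::
    "(nat \<times> nat) set \<Rightarrow> nat \<Rightarrow> (nat \<Rightarrow> nat) \<Rightarrow> nat \<Rightarrow> nat \<Rightarrow> bool" where
  "occurs_within G j \<alpha> a b \<longleftrightarrow>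
     (\<exists>r s. strict_mono_on {1..j} r \<and> strict_mono_on {1..j} s \<and>
        (\<forall>i\<in>{1..j}. (r i, s (\<alpha> i)) \<in> G \<and> r i \<le> a \<and> s i \<le> b))"

lemma involution_graph_subset:
  assumes "involution_graph A G"
  shows "G \<subseteq> A \<times> A"
  using assms by (auto simp: involution_graph_def sym_def)

text \<open>By \<open>permutes\<close> a permutation is the identity outside \<open>{1..n}\<close>,
  so its graph over \<open>{1..n}\<close> determines it. Conversely a symmetric single-valued
  relation is the graph of a self-inverse function on its domain, which extends by the
  identity.\<close>

lemma bij_betw_involution_graph:
  "bij_betw (\<lambda>\<pi>. (\<lambda>x. (x, \<pi> x)) ` {1..n}) {\<pi>. involution_on n \<pi>} {G. involution_graph {1..n} G}"
  unfolding bij_betw_def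
proof (intro conjI set_eqI iffI)
  show "inj_on (\<lambda>\<pi>. (\<lambda>x. (x, \<pi> x)) ` {1..n}) {\<pi>. involution_on n \<pi>}"
  proof (rule inj_onI, rule ext)
    fix \<pi> \<rho> x
    assume "\<pi> \<in> {\<pi>. involution_on n \<pi>}" "\<rho> \<in> {\<pi>. involution_on n \<pi>}"
      and eq: "(\<lambda>x. (x, \<pi> x)) ` {1..n} = (\<lambda>x. (x, \<rho> x)) ` {1..n}"
    then have perm: "\<pi> permutes {1..n}" "\<rho> permutes {1..n}"
      by (auto simp: involution_on_def)
    show "\<pi> x = \<rho> x"
    proof (cases "x \<in> {1..n}")
      case True
      then have "(x, \<pi> x) \<in> (\<lambda>x. (x, \<rho> x)) ` {1..n}"
        using eq by blast
      then show ?thesis by auto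
    next
      case False
      then show ?thesis using perm by (simp add: permutes_not_in)
    qed
  qed
next
  fix G assume "G \<in> (\<lambda>\<pi>. (\<lambda>x. (x, \<pi> x)) ` {1..n}) ` {\<pi>. involution_on n \<pi>}"
  then obtain \<pi> where \<pi>: "\<pi> permutes {1..n}" "\<pi> \<circ> \<pi> = id"
    and G: "G = (\<lambda>x. (x, \<pi> x)) ` {1..n}"
    by (auto simp: involution_on_def)
  have "\<pi> (\<pi> x) = x" for x
    using \<pi>(2) by (metis comp_apply id_apply)
  moreover have "\<pi> x \<in> {1..n}" if "x \<in> {1..n}" for x
    using \<pi>(1) that by (simp only: permutes_in_image)
  ultimately show "G \<in> {G. involution_graph {1..n} G}"
    unfolding G involution_graph_def sym_def single_valued_def by (auto simp: image_iff)
next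
  fix G assume "G \<in> {G. involution_graph {1..n} G}"
  then have symG: "\<And>x y. (x, y) \<in> G \<Longrightarrow> (y, x) \<in> G"
    and svG: "\<And>x y z. (x, y) \<in> G \<Longrightarrow> (x, z) \<in> G \<Longrightarrow> y = z"
    and dom: "Domain G = {1..n}"
    by (auto simp: involution_graph_def sym_def single_valued_def)
  have "\<forall>x\<in>{1..n}. \<exists>y. (x, y) \<in> G"
    unfolding dom[symmetric] by blast
  then obtain f where f: "\<And>x. x \<in> {1..n} \<Longrightarrow> (x, f x) \<in> G"
    by metis
  have fran: "f x \<in> {1..n}" if "x \<in> {1..n}" for x
    using symG[OF f[OF that]] dom by (metis Domain.DomainI)
  have ff: "f (f x) = x" if "x \<in> {1..n}" for x
    using svG symG f fran that by metis
  define \<pi> where "\<pi> = (\<lambda>x. if x \<in> {1..n} then f x else x)"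
  have inv: "\<pi> (\<pi> x) = x" for x
    using ff[of x] fran[of x] by (auto simp: \<pi>_def)
  have "\<pi> permutes {1..n}"
    unfolding permutes_def
  proof (intro conjI allI impI)
    show "\<exists>!x. \<pi> x = y" for y using inv by metis
  qed (auto simp: \<pi>_def)
  moreover have "\<pi> \<circ> \<pi> = id"
    using inv by auto
  moreover have "G = (\<lambda>x. (x, \<pi> x)) ` {1..n}"
  proof
    show "G \<subseteq> (\<lambda>x. (x, \<pi> x)) ` {1..n}"
    proof
      fix p assume p: "p \<in> G"
      obtain x y where xy: "p = (x, y)" by fastforce
      have x: "x \<in> {1..n}" using p xy dom by (metis Domain.DomainI)
      then have "y = f x" using svG[OF _ f] p xy by blast
      then show "p \<in> (\<lambda>x. (x, \<pi> x)) ` {1..n}"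
        using x xy by (auto simp: \<pi>_def)
    qed
    show "(\<lambda>x. (x, \<pi> x)) ` {1..n} \<subseteq> G"
      using f by (auto simp: \<pi>_def)
  qed
  ultimately show "G \<in> (\<lambda>\<pi>. (\<lambda>x. (x, \<pi> x)) ` {1..n}) ` {\<pi>. involution_on n \<pi>}"
    by (auto simp: involution_on_def)
qed

text \<open>In a strictly increasing list an entry fixes its position, so choosing a subsequence
  amounts to choosing a set of entries. For lists of positions this is a choice of columns.\<close>

lemma strict_sorted_subseq_iff:
  fixes xs zs :: "nat list"
  assumes "sorted_wrt (<) zs"
  shows "subseq xs zs \<longleftrightarrow> sorted_wrt (<) xs \<and> set xs \<subseteq> set zs"
proof
  assume "subseq xs zs"
  then obtain N where "xs = nths zs N"
    by (auto simp: subseq_conv_nths)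
  then show "sorted_wrt (<) xs \<and> set xs \<subseteq> set zs"
    using assms set_nths_subset[of zs N] by (auto simp: strict_sorted_iff sorted_nths)
next
  assume "sorted_wrt (<) xs \<and> set xs \<subseteq> set zs"
  then show "subseq xs zs"
    using assms by (intro sorted_subset_imp_subseq) (auto simp: strict_sorted_iff)
qed

text \<open>A subsequence of the one-line word is the image under \<pi> of an increasing list of
  positions, and these are the columns of the chosen dots.\<close>

lemma perm_avoids_iff_graph:
  "perm_avoids n \<pi> \<sigma> \<longleftrightarrow> \<not> word_occurs ((\<lambda>x. (x, \<pi> x)) ` {1..n}) \<sigma>"
proof -
  have sorted: "sorted_wrt (<) [1..<Suc n]"
    by (simp del: upt_Suc)
  have "(\<exists>ys. subseq ys (one_line n \<pi>) \<and> pattern_of ys = \<sigma>) \<longleftrightarrow>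
     (\<exists>xs. subseq xs [1..<Suc n] \<and> pattern_of (map \<pi> xs) = \<sigma>)"
    unfolding one_line_def subseq_conv_nths nths_map by metis
  also have "\<dots> \<longleftrightarrow> word_occurs ((\<lambda>x. (x, \<pi> x)) ` {1..n}) \<sigma>"
    unfolding strict_sorted_subseq_iff[OF sorted] word_occurs_def
  proof
    assume "\<exists>xs. (sorted_wrt (<) xs \<and> set xs \<subseteq> set [1..<Suc n]) \<and> pattern_of (map \<pi> xs) = \<sigma>"
    then obtain xs where xs: "sorted_wrt (<) xs" "set xs \<subseteq> {1..n}" "pattern_of (map \<pi> xs) = \<sigma>"
      by (auto simp: atLeastLessThanSuc_atLeastAtMost simp del: upt_Suc)
    let ?ds = "map (\<lambda>x. (x, \<pi> x)) xs"
    have "map fst ?ds = xs" "map snd ?ds = map \<pi> xs" by (simp_all add: comp_def)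
    moreover have "set ?ds \<subseteq> (\<lambda>x. (x, \<pi> x)) ` {1..n}" using xs(2) by auto
    ultimately show "\<exists>ds. set ds \<subseteq> (\<lambda>x. (x, \<pi> x)) ` {1..n} \<and> sorted_wrt (<) (map fst ds) \<and>
        pattern_of (map snd ds) = \<sigma>"
      using xs(1,3) by metis
  next
    assume "\<exists>ds. set ds \<subseteq> (\<lambda>x. (x, \<pi> x)) ` {1..n} \<and> sorted_wrt (<) (map fst ds) \<and>
        pattern_of (map snd ds) = \<sigma>"
    then obtain ds where ds: "set ds \<subseteq> (\<lambda>x. (x, \<pi> x)) ` {1..n}" "sorted_wrt (<) (map fst ds)"
      "pattern_of (map snd ds) = \<sigma>" by blast
    have "map snd ds = map \<pi> (map fst ds)" using ds(1) by auto
    moreover have "set (map fst ds) \<subseteq> set [1..<Suc n]"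
      using ds(1) by (auto simp: atLeastLessThanSuc_atLeastAtMost simp del: upt_Suc)
    ultimately show "\<exists>xs. (sorted_wrt (<) xs \<and> set xs \<subseteq> set [1..<Suc n]) \<and>
        pattern_of (map \<pi> xs) = \<sigma>"
      using ds(2,3) by metis
  qed
  finally show ?thesis by (simp add: perm_avoids_def)
qed

section \<open>Patterns of permutation words and of concatenations\<close>

lemma pattern_of_map_strict_mono:
  assumes "strict_mono_on (set ys) f"
  shows "pattern_of (map f ys) = pattern_of ys"
proof -
  have "card {z \<in> f ` set ys. z \<le> f y} = card {z \<in> set ys. z \<le> y}" if "y \<in> set ys" for y
  proof -
    have "{z \<in> f ` set ys. z \<le> f y} = f ` {z \<in> set ys. z \<le> y}"
      using assms that by (auto simp: strict_mono_on_less_eq)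
    moreover have "inj_on f {z \<in> set ys. z \<le> y}"
      using strict_mono_on_imp_inj_on[OF assms] by (rule inj_on_subset) auto
    ultimately show ?thesis by (simp add: card_image)
  qed
  then show ?thesis by (simp add: pattern_of_def)
qed

lemma nth_one_line:
  assumes "i \<in> {1..j}"
  shows "one_line j \<alpha> ! (i - 1) = \<alpha> i"
  using assms by (auto simp: one_line_def simp del: upt_Suc)

lemma length_one_line [simp]: "length (one_line j \<alpha>) = j"
  by (simp add: one_line_def)

lemma set_one_line:
  assumes "\<alpha> permutes {1..j}"
  shows "set (one_line j \<alpha>) = {1..j}"
  using permutes_image[OF assms]
  by (auto simp: one_line_def atLeastLessThanSuc_atLeastAtMost simp del: upt_Suc)

lemma pattern_of_one_line:
  assumes "\<alpha> permutes {1..j}"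
  shows "pattern_of (one_line j \<alpha>) = one_line j \<alpha>"
proof -
  note set = set_one_line[OF assms]
  have "card {z \<in> {1..j}. z \<le> y} = y" if "y \<in> {1..j}" for y
  proof -
    have "{z \<in> {1..j}. z \<le> y} = {1..y}" using that by auto
    then show ?thesis by simp
  qed
  then show ?thesis
    unfolding pattern_of_def set by (rule map_idI) (simp only: set)
qed

text \<open>The inverse of the rank function on the entries of \<open>ys\<close> serves as
  \<open>s\<close>. This replaces patterns by increasing reparametrizations, as needed for
  \<open>occurs_within\<close>.\<close>

lemma pattern_of_eq_one_line_iff:
  assumes "\<alpha> permutes {1..j}"
  shows "pattern_of ys = one_line j \<alpha> \<longleftrightarrow>
    (\<exists>s. strict_mono_on {1..j} s \<and> ys = map s (one_line j \<alpha>))"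
proof
  note set = set_one_line[OF assms]
  {
    assume "\<exists>s. strict_mono_on {1..j} s \<and> ys = map s (one_line j \<alpha>)"
    then show "pattern_of ys = one_line j \<alpha>"
      using pattern_of_map_strict_mono[of "one_line j \<alpha>"] pattern_of_one_line[OF assms] set
      by auto
  }
  assume pat: "pattern_of ys = one_line j \<alpha>"
  define rank where "rank = (\<lambda>y. card {z \<in> set ys. z \<le> y})"
  have pat': "map rank ys = one_line j \<alpha>"
    using pat by (simp add: pattern_of_def rank_def)
  have "mono rank"
    unfolding rank_def by (auto intro!: monoI card_mono)
  have rank_img: "rank ` set ys = {1..j}"
    using pat' set by (metis set_map)
  moreover have "length ys = j"
    using pat by (metis length_one_line length_pattern_of)
  \<comment> \<open>The at most \<open>j\<close> values in \<open>ys\<close> take \<open>j\<close>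
    different ranks, so \<open>rank\<close> is injective on them.\<close>
  ultimately have "card (set ys) \<le> card (rank ` set ys)"
    using card_length[of ys] by simp
  then have "inj_on rank (set ys)"
    by (intro eq_card_imp_inj_on antisym card_image_le) auto
  define s where "s = inv_into (set ys) rank"
  have "strict_mono_on {1..j} s"
  proof (rule strict_mono_onI)
    fix a b assume "a \<in> {1..j}" "b \<in> {1..j}" "a < b"
    then have "rank (s a) < rank (s b)"
      unfolding s_def by (simp only: rank_img[symmetric] f_inv_into_f)
    then show "s a < s b"
      using \<open>mono rank\<close> by (metis linorder_not_less monoD)
  qed
  moreover have "map s (one_line j \<alpha>) = ys"
    unfolding pat'[symmetric] s_def map_map
    by (intro map_idI) (simp add: \<open>inj_on rank (set ys)\<close>)
  ultimately show "\<exists>s. strict_mono_on {1..j} s \<and> ys = map s (one_line j \<alpha>)"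
    by metis
qed

text \<open>Every entry of \<open>us\<close> counts towards the rank of each entry of
  \<open>vs\<close>, and distinctness makes this contribution exactly \<open>length us\<close>;
  ranks inside \<open>us\<close> are unaffected by \<open>vs\<close>.\<close>

lemma pattern_of_append:
  assumes "distinct us" "\<And>u v. u \<in> set us \<Longrightarrow> v \<in> set vs \<Longrightarrow> u < v"
  shows "pattern_of (us @ vs) = pattern_of us @ map ((+) (length us)) (pattern_of vs)"
proof -
  have "{z \<in> set us \<union> set vs. z \<le> u} = {z \<in> set us. z \<le> u}" if "u \<in> set us" for u
    using assms(2) that by (auto dest: leD)
  moreover have "card {z \<in> set us \<union> set vs. z \<le> v} = length us + card {z \<in> set vs. z \<le> v}"
    if "v \<in> set vs" for v
  proof -
    have "{z \<in> set us \<union> set vs. z \<le> v} = set us \<union> {z \<in> set vs. z \<le> v}"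
      using assms(2) that by (auto intro: less_imp_le)
    moreover have "set us \<inter> {z \<in> set vs. z \<le> v} = {}"
      using assms(2) by blast
    ultimately show ?thesis
      using assms(1) by (simp add: card_Un_disjoint distinct_card)
  qed
  ultimately show ?thesis by (simp add: pattern_of_def)
qed

text \<open>The letters of \<rho> are at most \<open>j\<close> and those of \<tau> exceed
  \<open>j\<close>, so cutting \<open>ys\<close> after \<open>j\<close> entries leaves the first
  part entirely below the second. Then ranks can be computed in the two parts separately.\<close>

lemma pattern_of_eq_append_iff:
  assumes "distinct \<rho>" "set \<rho> = {1..j}" "length \<rho> = j" "set \<tau> \<subseteq> {j<..}" "distinct \<tau>"
  shows "pattern_of ys = \<rho> @ \<tau> \<longleftrightarrow> 
    (\<exists>us vs. ys = us @ vs \<and> pattern_of us = \<rho> \<and> map ((+) j) (pattern_of vs) = \<tau> \<and>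
      (\<forall>u\<in>set us. \<forall>v\<in>set vs. u < v))"
proof
  assume pat: "pattern_of ys = \<rho> @ \<tau>"
  define us vs where "us = take j ys" and "vs = drop j ys"
  have len: "length ys = j + length \<tau>"
    using arg_cong[OF pat, of length] assms(3) by simp
  have "distinct (\<rho> @ \<tau>)"
    using assms by auto
  then have "distinct ys"
    unfolding pat[symmetric] pattern_of_def by (simp add: distinct_map)
  have less: "u < v" if "u \<in> set us" "v \<in> set vs" for u v
  proof -
    from that obtain i k where i: "i < j" "u = ys ! i" and k: "k < length \<tau>" "v = ys ! (j + k)"
      using len by (auto simp: us_def vs_def in_set_conv_nth)
    have "\<rho> ! i \<in> {1..j}" "\<tau> ! k \<in> {j<..}"
      using i k assms by (metis nth_mem, metis nth_mem subsetD)
    then have "pattern_of ys ! i < pattern_of ys ! (j + k)"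
      unfolding pat using i k assms(3) by (auto simp: nth_append)
    then show ?thesis
      using i k len by (subst (asm) pattern_of_less_iff) auto
  qed
  have "ys = us @ vs" "length us = j"
    using len by (auto simp: us_def vs_def)
  moreover have "pattern_of us @ map ((+) j) (pattern_of vs) = \<rho> @ \<tau>"
    using pattern_of_append[of us vs] less \<open>distinct ys\<close> pat calculation by auto
  then have "pattern_of us = \<rho>" "map ((+) j) (pattern_of vs) = \<tau>"
    using \<open>length us = j\<close> assms(3) by auto
  ultimately show "\<exists>us vs. ys = us @ vs \<and> pattern_of us = \<rho> \<and> map ((+) j) (pattern_of vs) = \<tau> \<and>
      (\<forall>u\<in>set us. \<forall>v\<in>set vs. u < v)"
    using less by blast
next
  assume "\<exists>us vs. ys = us @ vs \<and> pattern_of us = \<rho> \<and> map ((+) j) (pattern_of vs) = \<tau> \<and>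
      (\<forall>u\<in>set us. \<forall>v\<in>set vs. u < v)"
  then obtain us vs where *: "ys = us @ vs" "pattern_of us = \<rho>" "map ((+) j) (pattern_of vs) = \<tau>"
    "\<And>u v. u\<in>set us \<Longrightarrow> v\<in>set vs \<Longrightarrow> u < v" by blast
  have "distinct us"
    using assms(1) unfolding *(2)[symmetric] pattern_of_def by (simp add: distinct_map)
  moreover have "length us = j"
    using * assms(3) by (metis length_pattern_of)
  ultimately show "pattern_of ys = \<rho> @ \<tau>"
    using pattern_of_append[of us vs] * by auto
qed

section \<open>The marked region and the role of the two factors of the pattern\<close>

text \<open>In its uses the letters of \<tau> exceed \<open>j\<close>, while a pattern starts at 1;
  hence the shift by \<open>j\<close>.\<close>

definition extension_at ::
    "(nat \<times> nat) set \<Rightarrow> nat \<Rightarrow> nat list \<Rightarrow> nat \<Rightarrow> nat \<Rightarrow> bool" where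
  "extension_at G j \<tau> x y \<longleftrightarrow>
     (\<exists>ds. set ds \<subseteq> G \<and> sorted_wrt (<) (map fst ds) \<and>
        map ((+) j) (pattern_of (map snd ds)) = \<tau> \<and> (\<forall>d\<in>set ds. x < fst d \<and> y < snd d))"

text \<open>Allowing both orientations of the box makes the region symmetric in the diagonal by
  construction.\<close>

definition region :: "nat \<Rightarrow> nat \<Rightarrow> nat list \<Rightarrow> (nat \<times> nat) set \<Rightarrow> (nat \<times> nat) set" where
  "region n j \<tau> G =
     {(x, y) \<in> {1..n} \<times> {1..n}. extension_at G j \<tau> x y \<or> extension_at G j \<tau> y x}"

text \<open>A Ferrers shape without its list of row lengths, possibly infinite; coordinates start at
  1 as in \<open>boxes\<close>.\<close>

definition down_closed :: "(nat \<times> nat) set \<Rightarrow> bool" where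
  "down_closed B \<longleftrightarrow> B \<subseteq> {1..} \<times> {1..} \<and>
     (\<forall>x y x' y'. (x, y) \<in> B \<and> x' \<in> {1..x} \<and> y' \<in> {1..y} \<longrightarrow> (x', y') \<in> B)"

lemma down_closedD:
  assumes "down_closed B" "(x, y) \<in> B" "1 \<le> x'" "x' \<le> x" "1 \<le> y'" "y' \<le> y"
  shows "(x', y') \<in> B"
  using assms unfolding down_closed_def by auto

text \<open>Reflection sends the dot \<open>(r i, s (\<alpha> i))\<close> to
  \<open>(s (\<alpha> i), r i)\<close>. Reindexing by \<alpha> yields
  \<open>(s i, r (\<alpha> i))\<close> because \<alpha> is its own inverse; for a general
  permutation the inverse pattern would appear.\<close>

lemma occurs_within_swap:
  assumes "involution_on j \<alpha>" "sym G" "occurs_within G j \<alpha> a b"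
  shows "occurs_within G j \<alpha> b a"
proof -
  obtain r s where rs: "strict_mono_on {1..j} r" "strict_mono_on {1..j} s"
    "\<And>i. i \<in> {1..j} \<Longrightarrow> (r i, s (\<alpha> i)) \<in> G \<and> r i \<le> a \<and> s i \<le> b"
    using assms(3) unfolding occurs_within_def by blast
  have \<alpha>: "\<alpha> i \<in> {1..j}" "\<alpha> (\<alpha> i) = i" if "i \<in> {1..j}" for i
    using assms(1) that permutes_in_image[of \<alpha> "{1..j}" i]
    by (simp_all add: involution_on_def fun_eq_iff)
  have "(s i, r (\<alpha> i)) \<in> G \<and> s i \<le> b \<and> r i \<le> a" if "i \<in> {1..j}" for i
    using rs(3)[OF \<alpha>(1)[OF that]] rs(3)[OF that] \<alpha>(2)[OF that] assms(2) by (auto simp: sym_def)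
  then show ?thesis
    unfolding occurs_within_def using rs by blast
qed

lemma occurs_within_iff_dots:
  assumes "\<alpha> permutes {1..j}"
  shows "occurs_within G j \<alpha> a b \<longleftrightarrow>
    (\<exists>ds. set ds \<subseteq> G \<and> sorted_wrt (<) (map fst ds) \<and> pattern_of (map snd ds) = one_line j \<alpha> \<and>
       (\<forall>d\<in>set ds. fst d \<le> a \<and> snd d \<le> b))"
proof
  assume "occurs_within G j \<alpha> a b"
  then obtain r s where rs: "strict_mono_on {1..j} r" "strict_mono_on {1..j} s"
    "\<And>i. i \<in> {1..j} \<Longrightarrow> (r i, s (\<alpha> i)) \<in> G \<and> r i \<le> a \<and> s i \<le> b"
    unfolding occurs_within_def by blast
  define ds where "ds = map (\<lambda>i. (r i, s (\<alpha> i))) [1..<Suc j]"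
  have set: "set ds = (\<lambda>i. (r i, s (\<alpha> i))) ` {1..j}"
    by (simp add: ds_def atLeastLessThanSuc_atLeastAtMost del: upt_Suc)
  have fst: "map fst ds = map r [1..<Suc j]"
    by (simp add: ds_def comp_def del: upt_Suc)
  have snd: "map snd ds = map s (one_line j \<alpha>)"
    by (simp add: ds_def comp_def one_line_def del: upt_Suc)
  have "sorted_wrt (<) (map r [1..<Suc j])"
    unfolding sorted_wrt_map
    by (rule sorted_wrt_mono_rel[of _ "(<)"])
      (use rs(1) in \<open>auto simp: strict_mono_on_def simp del: upt_Suc\<close>)
  moreover have "pattern_of (map snd ds) = one_line j \<alpha>"
    unfolding snd pattern_of_eq_one_line_iff[OF assms] using rs(2) by blast
  moreover have "\<alpha> i \<in> {1..j}" if "i \<in> {1..j}" for i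
    using assms that by (simp only: permutes_in_image)
  ultimately show "\<exists>ds. set ds \<subseteq> G \<and> sorted_wrt (<) (map fst ds) \<and>
      pattern_of (map snd ds) = one_line j \<alpha> \<and> (\<forall>d\<in>set ds. fst d \<le> a \<and> snd d \<le> b)"
    using rs(3) fst by (intro exI[of _ ds]) (force simp: set)
next
  assume "\<exists>ds. set ds \<subseteq> G \<and> sorted_wrt (<) (map fst ds) \<and>
      pattern_of (map snd ds) = one_line j \<alpha> \<and> (\<forall>d\<in>set ds. fst d \<le> a \<and> snd d \<le> b)"
  then obtain ds where ds: "set ds \<subseteq> G" "sorted_wrt (<) (map fst ds)"
      "pattern_of (map snd ds) = one_line j \<alpha>" "\<And>d. d \<in> set ds \<Longrightarrow> fst d \<le> a \<and> snd d \<le> b"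
    by blast
  obtain s where s: "strict_mono_on {1..j} s" "map snd ds = map s (one_line j \<alpha>)"
    using ds(3) pattern_of_eq_one_line_iff[OF assms] by blast
  have len: "length ds = j"
    using s(2) by (metis length_map length_one_line)
  define r where "r = (\<lambda>i. fst (ds ! (i - 1)))"
  have r: "strict_mono_on {1..j} r"
    using ds(2) len unfolding r_def sorted_wrt_map
    by (intro strict_mono_onI) (auto simp: sorted_wrt_iff_nth_less)
  have nth: "ds ! (i - 1) = (r i, s (\<alpha> i))" "ds ! (i - 1) \<in> set ds" if "i \<in> {1..j}" for i
  proof -
    have "snd (ds ! (i - 1)) = s (one_line j \<alpha> ! (i - 1))"
      using arg_cong[OF s(2), of "\<lambda>xs. xs ! (i - 1)"] that len by auto
    then show "ds ! (i - 1) = (r i, s (\<alpha> i))"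
      using nth_one_line[OF that] by (simp add: r_def prod_eq_iff)
    show "ds ! (i - 1) \<in> set ds" using that len by auto
  qed
  \<comment> \<open>The dots bound only the values \<open>s (\<alpha> k)\<close>; every index has
    the form \<open>\<alpha> k\<close> because \<alpha> maps onto \<open>{1..j}\<close>.\<close>
  have s_le: "s i \<le> b" if "i \<in> {1..j}" for i
  proof -
    from that obtain k where k: "k \<in> {1..j}" "i = \<alpha> k"
      using permutes_image[OF assms] by (metis imageE)
    then show ?thesis
      using nth(1)[OF k(1)] ds(4)[OF nth(2)[OF k(1)]] by simp
  qed
  show "occurs_within G j \<alpha> a b"
    unfolding occurs_within_def
  proof (intro exI conjI ballI)
    show "strict_mono_on {1..j} r" "strict_mono_on {1..j} s" by (fact r, fact s)
    fix i assume i: "i \<in> {1..j}"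
    show "(r i, s (\<alpha> i)) \<in> G" "r i \<le> a" "s i \<le> b"
      using nth[OF i] s_le[OF i] ds(1) ds(4)[OF nth(2)[OF i]] by auto
  qed
qed

lemma extension_at_mono:
  assumes "extension_at G j \<tau> x y" "G \<subseteq> H" "x' \<le> x" "y' \<le> y"
  shows "extension_at H j \<tau> x' y'"
proof -
  obtain ds where "set ds \<subseteq> G" "sorted_wrt (<) (map fst ds)"
    "map ((+) j) (pattern_of (map snd ds)) = \<tau>" "\<forall>d\<in>set ds. x < fst d \<and> y < snd d"
    using assms(1) unfolding extension_at_def by blast
  then show ?thesis
    unfolding extension_at_def using assms(2-4)
    by (intro exI[of _ ds]) (auto intro: le_less_trans)
qed

lemma region_subset: "region n j \<tau> G \<subseteq> {1..n} \<times> {1..n}"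
  by (auto simp: region_def)

lemma sym_region: "sym (region n j \<tau> G)"
  by (auto simp: region_def sym_def)

lemma down_closed_region: "down_closed (region n j \<tau> G)"
  unfolding down_closed_def region_def
  by (auto intro: extension_at_mono[OF _ order_refl])

text \<open>Cut a copy of the long pattern after its first \<open>j\<close> dots: the upper right
  corner of these dots is a marked box. Conversely, the copies of \<alpha> and \<tau> at a marked
  box can be joined, after a reflection if necessary.\<close>

lemma word_occurs_append_iff:
  assumes "j > 0" and \<alpha>: "involution_on j \<alpha>" and \<tau>: "distinct \<tau>" "set \<tau> \<subseteq> {j<..}"
    and G: "involution_graph {1..n} G"
  shows "word_occurs G (one_line j \<alpha> @ \<tau>) \<longleftrightarrow>
    (\<exists>(a, b)\<in>region n j \<tau> G. occurs_within G j \<alpha> a b)"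
proof -
  have perm: "\<alpha> permutes {1..j}" using \<alpha> by (simp add: involution_on_def)
  note set = set_one_line[OF perm]
  have dist: "distinct (one_line j \<alpha>)"
    using permutes_inj_on[OF perm] by (simp add: one_line_def distinct_map)
  note append_iff = pattern_of_eq_append_iff[OF dist set length_one_line \<tau>(2,1)]
  show ?thesis
  proof
    assume "word_occurs G (one_line j \<alpha> @ \<tau>)"
    then obtain ds us vs where ds: "set ds \<subseteq> G" "sorted_wrt (<) (map fst ds)"
      and split: "map snd ds = us @ vs" "pattern_of us = one_line j \<alpha>"
        "map ((+) j) (pattern_of vs) = \<tau>" "\<And>u v. u \<in> set us \<Longrightarrow> v \<in> set vs \<Longrightarrow> u < v"
      unfolding word_occurs_def append_iff by blast
    obtain ds1 ds2 where ds12: "ds = ds1 @ ds2" "map snd ds1 = us" "map snd ds2 = vs"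
      using split(1) by (auto simp: map_eq_append_conv)
    have "length ds1 = j"
      using ds12(2) split(2) by (metis length_map length_one_line length_pattern_of)
    then have ne: "set ds1 \<noteq> {}" using \<open>j > 0\<close> by auto
    \<comment> \<open>The upper right corner of the copy of \<alpha>; it exists because
      \<open>j > 0\<close>.\<close>
    define a b where "a = Max (fst ` set ds1)" and "b = Max (snd ` set ds1)"
    have a: "a \<in> fst ` set ds1" and b: "b \<in> snd ` set ds1"
      using ne by (auto simp: a_def b_def intro!: Max_in)
    then have "a \<in> {1..n}" "b \<in> {1..n}"
      using ds(1) ds12(1) involution_graph_subset[OF G] by auto
    moreover have "extension_at G j \<tau> a b"
      unfolding extension_at_def
    proof (intro exI[of _ ds2] conjI ballI)
      fix d assume d: "d \<in> set ds2"
      then show "b < snd d"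
        using b split(4) ds12(2,3) by fastforce
      show "a < fst d"
        using a d ds(2) ds12(1) by (auto simp: sorted_wrt_append)
    qed (use ds ds12 split(3) in \<open>auto simp: sorted_wrt_append\<close>)
    moreover have "occurs_within G j \<alpha> a b"
      unfolding occurs_within_iff_dots[OF perm] using ds ds12 split(2)
      by (intro exI[of _ ds1]) (auto simp: sorted_wrt_append a_def b_def)
    ultimately show "\<exists>(a, b)\<in>region n j \<tau> G. occurs_within G j \<alpha> a b"
      by (auto simp: region_def)
  next
    assume "\<exists>(a, b)\<in>region n j \<tau> G. occurs_within G j \<alpha> a b"
    moreover have "sym G" using G by (simp add: involution_graph_def)
    \<comment> \<open>If the copy of \<tau> lies beyond the reflected box, the copy of \<alpha> is
      reflected to match.\<close>
    ultimately obtain a b where "extension_at G j \<tau> a b" "occurs_within G j \<alpha> a b"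
      unfolding region_def using occurs_within_swap[OF \<alpha>] by blast
    then obtain ds1 ds2 where ds1: "set ds1 \<subseteq> G" "sorted_wrt (<) (map fst ds1)"
        "pattern_of (map snd ds1) = one_line j \<alpha>"
        "\<And>d. d \<in> set ds1 \<Longrightarrow> fst d \<le> a \<and> snd d \<le> b"
      and ds2: "set ds2 \<subseteq> G" "sorted_wrt (<) (map fst ds2)"
        "map ((+) j) (pattern_of (map snd ds2)) = \<tau>"
        "\<And>d. d \<in> set ds2 \<Longrightarrow> a < fst d \<and> b < snd d"
      unfolding occurs_within_iff_dots[OF perm] extension_at_def by blast
    have less: "fst d < fst d'" "snd d < snd d'" if "d \<in> set ds1" "d' \<in> set ds2" for d d'
      using ds1(4)[OF that(1)] ds2(4)[OF that(2)] by linarith+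
    have "pattern_of (map snd (ds1 @ ds2)) = one_line j \<alpha> @ \<tau>"
      unfolding append_iff using ds1(3) ds2(3) less(2)
      by (intro exI[of _ "map snd ds1"] exI[of _ "map snd ds2"]) auto
    moreover have "set (ds1 @ ds2) \<subseteq> G" "sorted_wrt (<) (map fst (ds1 @ ds2))"
      using ds1(1,2) ds2(1,2) less(1) by (auto simp: sorted_wrt_append)
    ultimately show "word_occurs G (one_line j \<alpha> @ \<tau>)"
      unfolding word_occurs_def by blast
  qed
qed

text \<open>If a copy of \<tau> beyond the box uses a dot in a marked box, then up to reflection
  another copy lies strictly beyond that dot and can be used instead. The coordinates stay bounded
  by \<open>n\<close>, so this process ends.\<close>

lemma extension_outside_region:
  assumes "(x, y) \<in> region n j \<tau> G"
  shows "extension_at (G - region n j \<tau> G) j \<tau> x y \<or> extension_at (G - region n j \<tau> G) j \<tau> y x"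
  using assms
proof (induction "2 * n - (x + y)" arbitrary: x y rule: less_induct)
  case less
  let ?E = "extension_at (G - region n j \<tau> G) j \<tau>"
  \<comment> \<open>The measure depends only on the sum of the coordinates, so one argument serves
    both orientations of the box.\<close>
  have step: "?E x' y' \<or> ?E y' x'"
    if xy': "x' + y' = x + y" and ext: "extension_at G j \<tau> x' y'" for x' y'
  proof -
    obtain ds where ds: "set ds \<subseteq> G" "sorted_wrt (<) (map fst ds)"
      "map ((+) j) (pattern_of (map snd ds)) = \<tau>" "\<And>d. d \<in> set ds \<Longrightarrow> x' < fst d \<and> y' < snd d"
      using ext unfolding extension_at_def by blast
    show ?thesis
    proof (cases "set ds \<inter> region n j \<tau> G = {}")
      case True
      then have "?E x' y'"
        unfolding extension_at_def using ds by (intro exI[of _ ds]) auto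
      then show ?thesis ..
    next
      case False
      then obtain p q where pq: "(p, q) \<in> set ds" "(p, q) \<in> region n j \<tau> G"
        by auto
      then have gt: "x' < p" "y' < q" and "p \<le> n" "q \<le> n"
        using ds(4) region_subset by fastforce+
      then have "2 * n - (p + q) < 2 * n - (x + y)"
        using xy' by linarith
      \<comment> \<open>The new copy lies beyond \<open>(p, q)\<close> or \<open>(q, p)\<close>,
        hence beyond \<open>(x', y')\<close> or \<open>(y', x')\<close>.\<close>
      from less.hyps[OF this pq(2)] show ?thesis
        using gt extension_at_mono[OF _ order_refl] by (meson less_imp_le)
    qed
  qed
  from less.prems have "extension_at G j \<tau> x y \<or> extension_at G j \<tau> y x"
    by (simp add: region_def)
  with step[of x y] step[of y x] show ?case by (auto simp: add.commute)
qed

text \<open>A mark for \<open>H\<close> has a witness among the dots outside the region of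
  \<open>H\<close>, and \<open>G\<close> shares these dots. Conversely, beyond a box outside that
  region all dots are outside it by down-closedness, so a copy of \<tau> in \<open>G\<close> found
  there is also a copy in \<open>H\<close>.\<close>

lemma region_eqI:
  assumes "G - region n j \<tau> H = H - region n j \<tau> H"
  shows "region n j \<tau> G = region n j \<tau> H"
proof
  show "region n j \<tau> H \<subseteq> region n j \<tau> G"
  proof
    fix d assume d: "d \<in> region n j \<tau> H"
    obtain x y where xy: "d = (x, y)" by fastforce
    have "H - region n j \<tau> H \<subseteq> G" using assms by blast
    then have "extension_at G j \<tau> x y \<or> extension_at G j \<tau> y x"
      using extension_outside_region[OF d[unfolded xy]] extension_at_mono by blast
    with d show "d \<in> region n j \<tau> G"
      by (auto simp: xy region_def)
  qed
  show "region n j \<tau> G \<subseteq> region n j \<tau> H"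
  proof (rule subsetI, rule ccontr)
    fix d assume d: "d \<in> region n j \<tau> G" "d \<notin> region n j \<tau> H"
    obtain x y where xy: "d = (x, y)" by fastforce
    have pos: "x \<in> {1..n}" "y \<in> {1..n}" using d(1) by (auto simp: xy region_def)
    have transfer: "extension_at H j \<tau> x' y'"
      if ext: "extension_at G j \<tau> x' y'" and out: "(x', y') \<notin> region n j \<tau> H"
        and pos: "1 \<le> x'" "1 \<le> y'" for x' y'
    proof -
      obtain ds where ds: "set ds \<subseteq> G" "sorted_wrt (<) (map fst ds)"
        "map ((+) j) (pattern_of (map snd ds)) = \<tau>" "\<And>d. d \<in> set ds \<Longrightarrow> x' < fst d \<and> y' < snd d"
        using ext unfolding extension_at_def by blast
      have "set ds \<inter> region n j \<tau> H = {}"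
        using ds(4) out down_closedD[OF down_closed_region, of _ _ n j \<tau> H x' y'] pos
        by (fastforce simp: less_imp_le)
      then have "set ds \<subseteq> H" using ds(1) assms by blast
      with ds show ?thesis unfolding extension_at_def by blast
    qed
    have "(y, x) \<notin> region n j \<tau> H"
      using d(2) sym_region by (metis symD xy)
    then have "extension_at H j \<tau> x y \<or> extension_at H j \<tau> y x"
      using d transfer pos by (auto simp: xy region_def)
    then show False using d(2) pos by (auto simp: xy region_def)
  qed
qed

section \<open>Self-conjugate shapes and symmetric full placements\<close>

text \<open>The length of a row is its largest column; down-closedness fills the row up to there and
  makes the lengths weakly decreasing. The last hypothesis excludes empty rows, so that all
  \<open>m\<close> lengths are positive.\<close>

lemma ex_self_conjugate_shape_boxes:
  assumes "down_closed B" "B \<subseteq> {1..m} \<times> {1..m}" "sym B" "\<And>y. y \<in> {1..m} \<Longrightarrow> \<exists>x. (x, y) \<in> B"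
  shows "\<exists>lam. ferrers_shape lam \<and> self_conjugate lam \<and> boxes lam = B"
proof -
  define row where "row = (\<lambda>y. Max {x. (x, y) \<in> B})"
  define lam where "lam = map row [1..<Suc m]"
  have fin: "finite {x. (x, y) \<in> B}" for y
    by (rule finite_subset[of _ "{1..m}"]) (use assms(2) in auto)
  have row_in: "(row y, y) \<in> B" if "y \<in> {1..m}" for y
    using Max_in[OF fin[of y]] assms(4)[OF that] by (auto simp: row_def)
  have row_ge: "x \<le> row y" if "(x, y) \<in> B" for x y
    using Max_ge[OF fin[of y]] that by (auto simp: row_def)
  have row_iff: "(x, y) \<in> B \<longleftrightarrow> 1 \<le> x \<and> x \<le> row y" if "y \<in> {1..m}" for x y
    using row_ge[of x y] row_in[OF that] down_closedD[OF assms(1) row_in[OF that], of x y]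
      assms(2) that by auto
  have nth: "lam ! (y - 1) = row y" if "y \<in> {1..m}" for y
    using that by (auto simp: lam_def simp del: upt_Suc)
  have len: "length lam = m" by (simp add: lam_def)
  have boxes: "boxes lam = B"
  proof (intro set_eqI)
    fix d :: "nat \<times> nat"
    obtain x y where d: "d = (x, y)" by fastforce
    show "d \<in> boxes lam \<longleftrightarrow> d \<in> B"
    proof (cases "y \<in> {1..m}")
      case True
      then show ?thesis using row_iff[OF True, of x] nth[OF True] len
        by (auto simp: d boxes_def)
    next
      case False
      then show ?thesis using assms(2) len by (auto simp: d boxes_def)
    qed
  qed
  moreover have "self_conjugate lam"
    using assms(3) unfolding self_conjugate_def boxes sym_def by blast
  moreover have "ferrers_shape lam"
  proof -
    have pos: "row y \<ge> 1" if "y \<in> {1..m}" for y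
      using row_in[OF that] assms(2) by auto
    have "row y' \<ge> row y" if "y' \<in> {1..m}" "y \<in> {1..m}" "y' \<le> y" for y y'
      using down_closedD[OF assms(1) row_in[OF that(2)], of "row y" y'] that pos[OF that(2)]
        row_ge by auto
    then have "sorted_wrt (\<ge>) lam"
      unfolding lam_def sorted_wrt_map
      by (intro sorted_wrt_mono_rel[of _ "(<)" "\<lambda>y y'. row y \<ge> row y'"])
        (auto simp del: upt_Suc)
    then show ?thesis
      using pos by (force simp: ferrers_shape_def lam_def simp del: upt_Suc)
  qed
  ultimately show ?thesis by blast
qed

text \<open>On a self-conjugate shape rows and columns have the same indices, and symmetry of the
  placement transfers existence and uniqueness of dots from columns to rows.\<close>

lemma symmetric_full_placement_iff:
  assumes "self_conjugate lam"
  shows "full_placement lam P \<and> symmetric_placement P \<longleftrightarrow>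
    P \<subseteq> boxes lam \<and> involution_graph (fst ` boxes lam) P"
proof -
  have img: "snd ` boxes lam = fst ` boxes lam"
    using assms unfolding self_conjugate_def by force
  show ?thesis
  proof
    assume l: "full_placement lam P \<and> symmetric_placement P"
    then have "placement lam P" "symmetric_placement P"
      and "\<forall>x\<in>fst ` boxes lam. \<exists>!y. (x, y) \<in> P"
      by (simp_all add: full_placement_def)
    then have sub: "P \<subseteq> boxes lam"
      and sv: "\<And>x y z. (x, y) \<in> P \<Longrightarrow> (x, z) \<in> P \<Longrightarrow> y = z"
      and symP: "\<And>x y. (x, y) \<in> P \<Longrightarrow> (y, x) \<in> P"
      and dom: "\<And>x. x \<in> fst ` boxes lam \<Longrightarrow> \<exists>y. (x, y) \<in> P"
      unfolding placement_def symmetric_placement_def by (simp, metis, metis, metis)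
    have "Domain P = fst ` boxes lam"
    proof
      show "Domain P \<subseteq> fst ` boxes lam"
        unfolding Domain_fst using sub by (rule image_mono)
      show "fst ` boxes lam \<subseteq> Domain P"
        using dom by (meson Domain.DomainI subsetI)
    qed
    then show "P \<subseteq> boxes lam \<and> involution_graph (fst ` boxes lam) P"
      using sub sv symP unfolding involution_graph_def sym_def single_valued_def by blast
  next
    assume r: "P \<subseteq> boxes lam \<and> involution_graph (fst ` boxes lam) P"
    then have symP: "\<And>x y. (x, y) \<in> P \<Longrightarrow> (y, x) \<in> P"
      and sv: "\<And>x y z. (x, y) \<in> P \<Longrightarrow> (x, z) \<in> P \<Longrightarrow> y = z"
      and dom: "\<And>x. x \<in> fst ` boxes lam \<Longrightarrow> \<exists>y. (x, y) \<in> P"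
      unfolding involution_graph_def sym_def single_valued_def by blast+
    have sv': "x = z" if "(x, y) \<in> P" "(z, y) \<in> P" for x y z
      using sv symP that by blast
    have pl: "placement lam P"
      unfolding placement_def using r sv sv' by blast
    have col: "\<exists>!y. (x, y) \<in> P" if "x \<in> fst ` boxes lam" for x
      using dom[OF that] sv by blast
    have row: "\<exists>!x. (x, y) \<in> P" if "y \<in> fst ` boxes lam" for y
      using dom[OF that] sv' symP by blast
    show "full_placement lam P \<and> symmetric_placement P"
      unfolding full_placement_def symmetric_placement_def img
      by (intro conjI ballI allI iffI pl row col) (assumption | erule symP)+
  qed
qed

text \<open>The upper right corner of a copy is the least box bounding it. As the shape is
  down-closed, it contains the corner as soon as it contains any bounding box.\<close>

lemma placement_contains_one_line_iff:
  assumes "\<alpha> permutes {1..j}" "j > 0" "P \<subseteq> boxes lam" "down_closed (boxes lam)"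
  shows "placement_contains lam P (one_line j \<alpha>) \<longleftrightarrow>
    (\<exists>(a, b)\<in>boxes lam. occurs_within P j \<alpha> a b)"
proof
  assume "placement_contains lam P (one_line j \<alpha>)"
  then obtain ds where ds: "set ds \<subseteq> P" "sorted_wrt (<) (map fst ds)"
    "pattern_of (map snd ds) = one_line j \<alpha>"
    "ds \<noteq> [] \<Longrightarrow> (Max (fst ` set ds), Max (snd ` set ds)) \<in> boxes lam"
    unfolding placement_contains_def by blast
  have "length ds = j"
    using ds(3) by (metis length_map length_one_line length_pattern_of)
  then have "ds \<noteq> []" using assms(2) by auto
  moreover have "occurs_within P j \<alpha> (Max (fst ` set ds)) (Max (snd ` set ds))"
    unfolding occurs_within_iff_dots[OF assms(1)] using ds by (intro exI[of _ ds]) auto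
  ultimately show "\<exists>(a, b)\<in>boxes lam. occurs_within P j \<alpha> a b"
    using ds(4) by blast
next
  assume "\<exists>(a, b)\<in>boxes lam. occurs_within P j \<alpha> a b"
  then obtain a b ds where ab: "(a, b) \<in> boxes lam" and ds: "set ds \<subseteq> P" "sorted_wrt (<) (map fst ds)"
    "pattern_of (map snd ds) = one_line j \<alpha>" "\<And>d. d \<in> set ds \<Longrightarrow> fst d \<le> a \<and> snd d \<le> b"
    unfolding occurs_within_iff_dots[OF assms(1)] by blast
  have "(Max (fst ` set ds), Max (snd ` set ds)) \<in> boxes lam" if "ds \<noteq> []"
  proof -
    have "Max (fst ` set ds) \<in> fst ` set ds" "Max (snd ` set ds) \<in> snd ` set ds"
      using that by (auto intro!: Max_in)
    moreover have "\<And>d. d \<in> set ds \<Longrightarrow> d \<in> {1..} \<times> {1..}"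
      using ds(1) assms(3,4) by (auto simp: down_closed_def)
    ultimately show ?thesis
      using ds(4) by (intro down_closedD[OF assms(4) ab]) fastforce+
  qed
  then show "placement_contains lam P (one_line j \<alpha>)"
    unfolding placement_contains_def using ds by blast
qed

section \<open>Deleting the rows and columns of the outer dots\<close>

text \<open>The dots outside \<open>B\<close> are frozen. Deleting their rows and columns and
  renumbering the rest turns \<open>B\<close> into a shape, on which the dots inside
  \<open>B\<close> form an arbitrary symmetric full placement. The shape is chosen before \<alpha>,
  so one shape serves all patterns of length \<open>j\<close>.\<close>

lemma card_fixed_outside_eq_num_symmetric_avoiding:
  assumes G0: "involution_graph {1..n} G0"
    and B: "down_closed B" "B \<subseteq> {1..n} \<times> {1..n}" "sym B" and "j > 0"
  shows "\<exists>lam. ferrers_shape lam \<and> self_conjugate lam \<and>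
    (\<forall>\<alpha>. \<alpha> permutes {1..j} \<longrightarrow>
      card {G. involution_graph {1..n} G \<and> G - B = G0 - B \<and>
              \<not> (\<exists>(a, b)\<in>B. occurs_within G j \<alpha> a b)} =
      num_symmetric_avoiding lam (one_line j \<alpha>))"
proof -
  \<comment> \<open>The retained columns, and by symmetry of \<open>G0\<close> and \<open>B\<close>
    also the retained rows. Every other column in \<open>{1..n}\<close> carries a frozen
    dot.\<close>
  define R where "R = Domain (G0 \<inter> B)"
  define m where "m = card R"
  have "finite R"
    unfolding R_def using B(2) by (meson finite_Domain finite_Int finite_SigmaI finite_atLeastAtMost finite_subset)
  then obtain h where h: "bij_betw h {..<m} R" "strict_mono_on {..<m} h"
    unfolding m_def by (rule ex_bij_betw_strict_mono_card)
  \<comment> \<open>\<open>h\<close> counts from 0, whereas boxes count from 1.\<close>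
  define e where "e = (\<lambda>i. h (i - 1))"
  have e_mono: "strict_mono_on {1..m} e"
    unfolding e_def by (intro strict_mono_onI) (auto intro!: strict_mono_onD[OF h(2)])
  have e_inj: "inj_on e {1..m}"
    using strict_mono_on_imp_inj_on[OF e_mono] .
  have e_img: "e ` {1..m} = R"
  proof -
    have "e ` {1..m} = h ` {..<m}"
      unfolding image_Suc_lessThan[symmetric] image_image e_def by simp
    then show ?thesis using h(1) by (simp add: bij_betw_def)
  qed
  have e_le: "e x \<le> e y \<longleftrightarrow> x \<le> y" if "x \<in> {1..m}" "y \<in> {1..m}" for x y
    using e_mono that by (simp add: strict_mono_on_less_eq)
  have R: "R \<subseteq> {1..n}" using B(2) by (auto simp: R_def)

  \<comment> \<open>\<open>B\<close> on the retained rows and columns, renumbered.\<close>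
  define C where "C = {(x, y) \<in> {1..m} \<times> {1..m}. (e x, e y) \<in> B}"
  have C_down: "down_closed C"
    unfolding down_closed_def
  proof (intro conjI allI impI)
    fix x y x' y' assume *: "(x, y) \<in> C \<and> x' \<in> {1..x} \<and> y' \<in> {1..y}"
    then have "x' \<in> {1..m}" "y' \<in> {1..m}" "(e x, e y) \<in> B" "e x' \<le> e x" "e y' \<le> e y"
      by (auto simp: C_def e_le)
    moreover from this have "1 \<le> e x'" "1 \<le> e y'"
      using e_img R by (metis atLeastAtMost_iff image_eqI subsetD)+
    ultimately show "(x', y') \<in> C"
      using down_closedD[OF B(1)] by (auto simp: C_def)
  qed (auto simp: C_def)
  have G0_sym: "\<And>x y. (x, y) \<in> G0 \<Longrightarrow> (y, x) \<in> G0"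
    and G0_sv: "\<And>x y z. (x, y) \<in> G0 \<Longrightarrow> (x, z) \<in> G0 \<Longrightarrow> y = z"
    and G0_dom: "Domain G0 = {1..n}"
    using G0 by (auto simp: involution_graph_def sym_def single_valued_def)
  have B_sym: "\<And>x y. (x, y) \<in> B \<Longrightarrow> (y, x) \<in> B"
    using B(3) by (auto simp: sym_def)
  \<comment> \<open>The dot of \<open>G0\<close> in a retained column lies in \<open>B\<close>, and
    so does its reflection, so its other coordinate is retained as well.\<close>
  have C_row: "\<exists>x. (x, y) \<in> C" if "y \<in> {1..m}" for y
  proof -
    have "e y \<in> R" using e_img that by blast
    then obtain z where z: "(e y, z) \<in> G0" "(e y, z) \<in> B"
      by (auto simp: R_def)
    then have "(z, e y) \<in> G0 \<inter> B" using G0_sym B_sym by blast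
    then have "z \<in> R" unfolding R_def by blast
    then obtain x where "x \<in> {1..m}" "z = e x" using e_img by blast
    then show ?thesis using z that B_sym by (auto simp: C_def)
  qed
  have "sym C" using B_sym by (auto simp: C_def sym_def)
  moreover have "C \<subseteq> {1..m} \<times> {1..m}" by (auto simp: C_def)
  ultimately obtain lam where lam: "ferrers_shape lam" "self_conjugate lam" "boxes lam = C"
    using ex_self_conjugate_shape_boxes[OF C_down _ _ C_row] by blast
  have C_dom: "fst ` C = {1..m}"
  proof
    show "fst ` C \<subseteq> {1..m}" by (auto simp: C_def)
    show "{1..m} \<subseteq> fst ` C"
      using C_row \<open>sym C\<close> by (force simp: sym_def)
  qed

  define F where "F = (\<lambda>P. (G0 - B) \<union> map_prod e e ` P)"
  have img_sub: "map_prod e e ` P \<subseteq> B" if "P \<subseteq> C" for P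
    using that by (auto simp: C_def)
  have R_out: "x \<notin> R" if "(x, y) \<in> G0 - B" for x y
    using that G0_sv by (auto simp: R_def)
  have F_graph: "involution_graph {1..n} (F P) \<and> F P - B = G0 - B"
    if P: "P \<subseteq> C" "involution_graph {1..m} P" for P
  proof -
    let ?Q = "map_prod e e ` P"
    have P_sym: "\<And>x y. (x, y) \<in> P \<Longrightarrow> (y, x) \<in> P"
      and P_sv: "\<And>x y z. (x, y) \<in> P \<Longrightarrow> (x, z) \<in> P \<Longrightarrow> y = z"
      and P_dom: "Domain P = {1..m}"
      using P(2) by (auto simp: involution_graph_def sym_def single_valued_def)
    have P_sub: "P \<subseteq> {1..m} \<times> {1..m}" using P(1) by (auto simp: C_def)
    have "Domain ?Q = e ` Domain P" by force
    then have Q_dom: "Domain ?Q = R" by (simp only: P_dom e_img)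
    have Q_sv: "single_valued ?Q"
    proof (rule single_valuedI)
      fix x y z assume "(x, y) \<in> ?Q" "(x, z) \<in> ?Q"
      then obtain p q r s where "(p, q) \<in> P" "(r, s) \<in> P" "x = e p" "x = e r" "y = e q" "z = e s"
        by auto
      moreover from this have "p = r"
        using P_sub e_inj by (metis (no_types, lifting) SigmaD1 inj_onD subsetD)
      ultimately show "y = z" using P_sv by blast
    qed
    have "single_valued (F P)"
    proof (rule single_valuedI)
      fix x y z assume xyz: "(x, y) \<in> F P" "(x, z) \<in> F P"
      show "y = z"
      \<comment> \<open>Columns in \<open>R\<close> carry only dots coming from \<open>P\<close>,
        all others only frozen dots.\<close>
      proof (cases "x \<in> R")
        case True
        then have "(x, y) \<in> ?Q" "(x, z) \<in> ?Q" using xyz R_out unfolding F_def by blast+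
        with Q_sv show ?thesis by (rule single_valuedD)
      next
        case False
        then have "(x, y) \<in> G0" "(x, z) \<in> G0" using xyz Q_dom unfolding F_def by blast+
        then show ?thesis by (rule G0_sv)
      qed
    qed
    moreover have "sym ?Q" using P_sym by (force simp: sym_def)
    then have "sym (F P)"
      using G0_sym B_sym unfolding F_def sym_def by blast
    moreover have "Domain (F P) = {1..n}"
    proof -
      have "Domain (F P) = Domain (G0 - B) \<union> Domain (G0 \<inter> B)"
        unfolding F_def Domain_Un_eq Q_dom R_def ..
      also have "\<dots> = Domain G0" by blast
      finally show ?thesis using G0_dom by simp
    qed
    moreover have "F P - B = G0 - B"
      unfolding F_def using img_sub[OF P(1)] by blast
    ultimately show ?thesis by (simp add: involution_graph_def)
  qed
  have "bij_betw F {P. P \<subseteq> C \<and> involution_graph {1..m} P}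
      {G. involution_graph {1..n} G \<and> G - B = G0 - B}"
    unfolding bij_betw_def
  proof (intro conjI set_eqI iffI)
    show "inj_on F {P. P \<subseteq> C \<and> involution_graph {1..m} P}"
    proof (rule inj_onI)
      fix P Q assume "P \<in> {P. P \<subseteq> C \<and> involution_graph {1..m} P}"
        "Q \<in> {P. P \<subseteq> C \<and> involution_graph {1..m} P}" and eq: "F P = F Q"
      then have PQ: "P \<subseteq> C" "Q \<subseteq> C" by auto
      then have "map_prod e e ` P = F P \<inter> B" "map_prod e e ` Q = F Q \<inter> B"
        using img_sub[OF PQ(1)] img_sub[OF PQ(2)] unfolding F_def by blast+
      then have "map_prod e e ` P = map_prod e e ` Q" using eq by simp
      moreover have "inj_on (map_prod e e) ({1..m} \<times> {1..m})"
        using e_inj by (rule map_prod_inj_on) (rule e_inj)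
      ultimately show "P = Q"
        using PQ \<open>C \<subseteq> {1..m} \<times> {1..m}\<close> by (meson inj_on_image_eq_iff order.trans)
    qed
  next
    fix G assume "G \<in> F ` {P. P \<subseteq> C \<and> involution_graph {1..m} P}"
    then show "G \<in> {G. involution_graph {1..n} G \<and> G - B = G0 - B}"
      using F_graph by blast
  next
    fix G assume "G \<in> {G. involution_graph {1..n} G \<and> G - B = G0 - B}"
    then have G_sym: "\<And>x y. (x, y) \<in> G \<Longrightarrow> (y, x) \<in> G"
      and G_sv: "\<And>x y z. (x, y) \<in> G \<Longrightarrow> (x, z) \<in> G \<Longrightarrow> y = z"
      and G_dom: "Domain G = {1..n}" and G_out: "G - B = G0 - B"
      by (auto simp: involution_graph_def sym_def single_valued_def)
    \<comment> \<open>A column outside \<open>R\<close> has its \<open>G0\<close>-dot outside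
      \<open>B\<close>. That dot belongs to \<open>G\<close> too and leaves no room for a dot of
      \<open>G\<close> inside \<open>B\<close>.\<close>
    have GB: "x \<in> R \<and> y \<in> R" if "(x, y) \<in> G \<inter> B" for x y
    proof -
      have *: "x \<in> R" if xy: "(x, y) \<in> G" "(x, y) \<in> B" for x y
      proof (rule ccontr)
        assume "x \<notin> R"
        have "x \<in> Domain G0" using xy G_dom G0_dom by blast
        then obtain z where "(x, z) \<in> G0" by blast
        with \<open>x \<notin> R\<close> have "(x, z) \<in> G - B" unfolding R_def G_out by blast
        then show False using xy G_sv by blast
      qed
      from that show ?thesis using * G_sym B_sym by blast
    qed
    \<comment> \<open>Conversely, a dot of \<open>G\<close> outside \<open>B\<close> is frozen, so
      its column is not in \<open>R\<close>.\<close>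
    have RG: "\<exists>y. (x, y) \<in> G \<inter> B" if "x \<in> R" for x
    proof -
      have "x \<in> Domain G" using that R G_dom by blast
      then obtain y where "(x, y) \<in> G" by blast
      moreover have "(x, y) \<in> B" using R_out[of x y] that calculation G_out by blast
      ultimately show ?thesis by blast
    qed
    \<comment> \<open>The preimage of \<open>G\<close> under \<open>F\<close>: its dots inside
      \<open>B\<close>, renumbered.\<close>
    define P where "P = {(x, y) \<in> {1..m} \<times> {1..m}. (e x, e y) \<in> G \<inter> B}"
    have "P \<subseteq> C" by (auto simp: P_def C_def)
    moreover have "involution_graph {1..m} P"
      unfolding involution_graph_def
    proof (intro conjI)
      show "sym P" using G_sym B_sym by (auto simp: P_def sym_def)
      show "single_valued P"
        using G_sv e_inj unfolding P_def single_valued_def inj_on_def by blast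
      show "Domain P = {1..m}"
      proof
        show "{1..m} \<subseteq> Domain P"
        proof
          fix x assume x: "x \<in> {1..m}"
          then obtain z where z: "(e x, z) \<in> G \<inter> B" using RG e_img by blast
          then obtain y where "y \<in> {1..m}" "z = e y" using GB e_img by blast
          with x z have "(x, y) \<in> P" by (simp add: P_def)
          then show "x \<in> Domain P" by blast
        qed
      qed (auto simp: P_def)
    qed
    moreover have "map_prod e e ` P = G \<inter> B"
    proof
      show "G \<inter> B \<subseteq> map_prod e e ` P"
      proof
        fix d assume d: "d \<in> G \<inter> B"
        obtain u v where uv: "d = (u, v)" by fastforce
        then have "u \<in> R" "v \<in> R" using GB d by blast+
        then obtain x where x: "x \<in> {1..m}" "u = e x" using e_img by blast
        obtain y where y: "y \<in> {1..m}" "v = e y" using \<open>v \<in> R\<close> e_img by blast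
        have "(x, y) \<in> P" using x y d uv by (simp add: P_def)
        then show "d \<in> map_prod e e ` P" using x y uv by (metis image_eqI map_prod_simp)
      qed
    qed (auto simp: P_def)
    then have "F P = G" unfolding F_def using G_out by blast
    ultimately show "G \<in> F ` {P. P \<subseteq> C \<and> involution_graph {1..m} P}" by blast
  qed
  \<comment> \<open>The renumbering preserves order, and a copy bounded by a box of \<open>B\<close>
    lies in \<open>B\<close> by down-closedness, so frozen dots never take part.\<close>
  moreover have occ: "(\<exists>(a, b)\<in>B. occurs_within (F P) j \<alpha> a b) \<longleftrightarrow>
      (\<exists>(a, b)\<in>C. occurs_within P j \<alpha> a b)"
    if \<alpha>: "\<alpha> permutes {1..j}" and P: "P \<subseteq> C" for P \<alpha>
  proof
    assume "\<exists>(a, b)\<in>C. occurs_within P j \<alpha> a b"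
    then obtain a b r s where ab: "(a, b) \<in> C" and rs: "strict_mono_on {1..j} r" "strict_mono_on {1..j} s"
      "\<And>i. i \<in> {1..j} \<Longrightarrow> (r i, s (\<alpha> i)) \<in> P \<and> r i \<le> a \<and> s i \<le> b"
      unfolding occurs_within_def by blast
    have in_m: "r i \<in> {1..m} \<and> s (\<alpha> i) \<in> {1..m}" if "i \<in> {1..j}" for i
      using rs(3)[OF that] P by (auto simp: C_def)
    have r_in: "r i \<in> {1..m}" if "i \<in> {1..j}" for i using in_m[OF that] by blast
    have s_in: "s i \<in> {1..m}" if "i \<in> {1..j}" for i
      using in_m that permutes_image[OF \<alpha>] by (metis imageE)
    have "occurs_within (F P) j \<alpha> (e a) (e b)"
      unfolding occurs_within_def
    proof (intro exI conjI ballI)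
      show "strict_mono_on {1..j} (\<lambda>i. e (r i))"
        using rs(1) e_mono r_in unfolding strict_mono_on_def by blast
      show "strict_mono_on {1..j} (\<lambda>i. e (s i))"
        using rs(2) e_mono s_in unfolding strict_mono_on_def by blast
    next
      fix i assume i: "i \<in> {1..j}"
      show "(e (r i), e (s (\<alpha> i))) \<in> F P" using rs(3)[OF i] by (force simp: F_def)
      show "e (r i) \<le> e a" "e (s i) \<le> e b"
        using rs(3)[OF i] r_in[OF i] s_in[OF i] ab by (auto simp: C_def e_le)
    qed
    moreover have "(e a, e b) \<in> B" using ab by (simp add: C_def)
    ultimately show "\<exists>(a, b)\<in>B. occurs_within (F P) j \<alpha> a b" by blast
  next
    assume "\<exists>(a, b)\<in>B. occurs_within (F P) j \<alpha> a b"
    then obtain a b r s where ab: "(a, b) \<in> B" and rs: "strict_mono_on {1..j} r" "strict_mono_on {1..j} s"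
      "\<And>i. i \<in> {1..j} \<Longrightarrow> (r i, s (\<alpha> i)) \<in> F P \<and> r i \<le> a \<and> s i \<le> b"
      unfolding occurs_within_def by blast
    have \<alpha>_in: "\<alpha> i \<in> {1..j}" if "i \<in> {1..j}" for i
      using \<alpha> that by (simp only: permutes_in_image)
    have F_sub: "F P \<subseteq> {1..} \<times> {1..}"
      using involution_graph_subset[OF G0] img_sub[OF P] B(2) unfolding F_def by fastforce
    have dot: "\<exists>x y. (x, y) \<in> P \<and> r i = e x \<and> s (\<alpha> i) = e y" if i: "i \<in> {1..j}" for i
    proof -
      have "(r i, s (\<alpha> i)) \<in> B"
        using rs(3)[OF i] rs(3)[OF \<alpha>_in[OF i]] F_sub
        by (intro down_closedD[OF B(1) ab]) auto
      then have "(r i, s (\<alpha> i)) \<in> map_prod e e ` P"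
        using rs(3)[OF i] by (auto simp: F_def)
      then show ?thesis by auto
    qed
    define f where "f = inv_into {1..m} e"
    have f: "f (e x) = x" if "x \<in> {1..m}" for x
      using inv_into_f_f[OF e_inj that] by (simp add: f_def)
    have r_in: "r i \<in> R" if "i \<in> {1..j}" for i
      using dot[OF that] P e_img by (auto simp: C_def)
    have s_in: "s i \<in> R" if i: "i \<in> {1..j}" for i
    proof -
      obtain k where "k \<in> {1..j}" "i = \<alpha> k" using i permutes_image[OF \<alpha>] by (metis imageE)
      then show ?thesis using dot[of k] P e_img by (auto simp: C_def)
    qed
    have f_mono: "f u < f v" if "u \<in> R" "v \<in> R" "u < v" for u v
    proof -
      obtain x where x: "x \<in> {1..m}" "u = e x"
        using \<open>u \<in> R\<close> e_img by blast
      obtain y where y: "y \<in> {1..m}" "v = e y"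
        using \<open>v \<in> R\<close> e_img by blast
      show ?thesis
        using e_le[OF y(1) x(1)] \<open>u < v\<close> x y by (simp add: f)
    qed
    have f_mono': "f u \<le> f v" if "u \<in> R" "v \<in> R" "u \<le> v" for u v
      using f_mono[OF that(1,2)] that(3) by (cases "u = v") auto
    \<comment> \<open>The bounding box \<open>(a, b)\<close> need not lie on retained lines. It is
      replaced by \<open>(r j, s j)\<close>, the corner of the copy itself, since \<open>j\<close>
      is the largest index.\<close>
    have mono_rs: "r i \<le> r j" "s i \<le> s j" if "i \<in> {1..j}" for i
      using rs(1,2) that \<open>j > 0\<close> by (auto simp: strict_mono_on_leD)
    have j: "j \<in> {1..j}" using \<open>j > 0\<close> by auto
    have Pf: "(f (r i), f (s (\<alpha> i))) \<in> P" if "i \<in> {1..j}" for i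
      using dot[OF that] P f by (auto simp: C_def)
    have "occurs_within P j \<alpha> (f (r j)) (f (s j))"
      unfolding occurs_within_def
    proof (intro exI conjI ballI)
      show "strict_mono_on {1..j} (\<lambda>i. f (r i))"
        using rs(1) f_mono r_in unfolding strict_mono_on_def by blast
      show "strict_mono_on {1..j} (\<lambda>i. f (s i))"
        using rs(2) f_mono s_in unfolding strict_mono_on_def by blast
    next
      fix i assume i: "i \<in> {1..j}"
      show "(f (r i), f (s (\<alpha> i))) \<in> P" using Pf[OF i] .
      show "f (r i) \<le> f (r j)" "f (s i) \<le> f (s j)"
        using f_mono' r_in s_in mono_rs i j by auto
    qed
    moreover have "(f (r j), f (s j)) \<in> C"
    proof -
      obtain x where x: "x \<in> {1..m}" "r j = e x" using r_in[OF j] e_img by blast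
      obtain y where y: "y \<in> {1..m}" "s j = e y" using s_in[OF j] e_img by blast
      have "(r j, s j) \<in> B"
        using rs(3)[OF j] r_in[OF j] s_in[OF j] R by (intro down_closedD[OF B(1) ab]) auto
      then show ?thesis using x y f by (auto simp: C_def)
    qed
    ultimately show "\<exists>(a, b)\<in>C. occurs_within P j \<alpha> a b" by blast
  qed
  ultimately have bij: "bij_betw F
      {P \<in> {P. P \<subseteq> C \<and> involution_graph {1..m} P}. \<not> (\<exists>(a, b)\<in>C. occurs_within P j \<alpha> a b)}
      {G \<in> {G. involution_graph {1..n} G \<and> G - B = G0 - B}. \<not> (\<exists>(a, b)\<in>B. occurs_within G j \<alpha> a b)}"
    if "\<alpha> permutes {1..j}" for \<alpha>
    using that by (intro bij_betw_Collect) auto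
  have "num_symmetric_avoiding lam (one_line j \<alpha>) = card
      {G. involution_graph {1..n} G \<and> G - B = G0 - B \<and> \<not> (\<exists>(a, b)\<in>B. occurs_within G j \<alpha> a b)}"
    if \<alpha>: "\<alpha> permutes {1..j}" for \<alpha>
  proof -
    have "{P. full_placement lam P \<and> symmetric_placement P \<and> \<not> placement_contains lam P (one_line j \<alpha>)} =
      {P \<in> {P. P \<subseteq> C \<and> involution_graph {1..m} P}. \<not> (\<exists>(a, b)\<in>C. occurs_within P j \<alpha> a b)}"
      using symmetric_full_placement_iff[OF lam(2)]
        placement_contains_one_line_iff[OF \<alpha> \<open>j > 0\<close>, of _ lam] C_down
      unfolding lam(3) C_dom by blast
    then show ?thesis
      using bij_betw_same_card[OF bij[OF \<alpha>]] unfolding num_symmetric_avoiding_def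
      by (simp add: conj_assoc)
  qed
  then show ?thesis using lam by (intro exI[of _ lam]) auto
qed

section \<open>Counting involutions by their outer dots\<close>

lemma num_involutions_avoiding_eq_card_graphs:
  assumes "j > 0" "involution_on j \<alpha>" "distinct \<tau>" "set \<tau> \<subseteq> {j<..}"
  shows "num_involutions_avoiding n (one_line j \<alpha> @ \<tau>) =
    card {G. involution_graph {1..n} G \<and> \<not> (\<exists>(a, b)\<in>region n j \<tau> G. occurs_within G j \<alpha> a b)}"
proof -
  have "bij_betw (\<lambda>\<pi>. (\<lambda>x. (x, \<pi> x)) ` {1..n})
      {\<pi> \<in> {\<pi>. involution_on n \<pi>}. perm_avoids n \<pi> (one_line j \<alpha> @ \<tau>)}
      {G \<in> {G. involution_graph {1..n} G}. \<not> word_occurs G (one_line j \<alpha> @ \<tau>)}"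
    using bij_betw_involution_graph by (rule bij_betw_Collect) (simp add: perm_avoids_iff_graph)
  moreover have "{G \<in> {G. involution_graph {1..n} G}. \<not> word_occurs G (one_line j \<alpha> @ \<tau>)} =
      {G. involution_graph {1..n} G \<and> \<not> (\<exists>(a, b)\<in>region n j \<tau> G. occurs_within G j \<alpha> a b)}"
    using word_occurs_append_iff[OF assms] by blast
  ultimately show ?thesis
    unfolding num_involutions_avoiding_def by (simp add: bij_betw_same_card)
qed

text \<open>Involutions are grouped by marked region and outer dots. The avoiders in a group are
  counted by symmetric placements on a shape that depends on the group but not on the prefix, so the
  hypothesis on shapes equates the counts group by group.\<close>

lemma num_involutions_avoiding_exchange:
  assumes "j > 0" and \<alpha>: "involution_on j \<alpha>" and \<beta>: "involution_on j \<beta>"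
    and shapes: "\<And>lam. ferrers_shape lam \<Longrightarrow> self_conjugate lam \<Longrightarrow>
           num_symmetric_avoiding lam (one_line j \<alpha>) = num_symmetric_avoiding lam (one_line j \<beta>)"
    and \<tau>: "distinct \<tau>" "set \<tau> \<subseteq> {j<..}"
  shows "num_involutions_avoiding n (one_line j \<alpha> @ \<tau>) =
         num_involutions_avoiding n (one_line j \<beta> @ \<tau>)"
proof -
  let ?L = "region n j \<tau>"
  define I where "I = {G. involution_graph {1..n} G}"
  define A where "A = (\<lambda>\<gamma>. {G \<in> I. \<not> (\<exists>(a, b)\<in>?L G. occurs_within G j \<gamma> a b)})"
  define key where "key = (\<lambda>G. (?L G, G - ?L G))"
  have "finite I"
    unfolding I_def
    by (rule finite_subset[of _ "Pow ({1..n} \<times> {1..n})"]) (use involution_graph_subset in auto)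
  have split: "card (A \<gamma>) = (\<Sum>k\<in>key ` I. card {G \<in> A \<gamma>. key G = k})" for \<gamma>
  proof -
    have "A \<gamma> \<subseteq> I" by (auto simp: A_def)
    then show ?thesis
      unfolding card_eq_sum using \<open>finite I\<close>
      by (intro sum.group[symmetric] finite_imageI image_mono) (auto intro: finite_subset)
  qed
  have "card {G \<in> A \<alpha>. key G = k} = card {G \<in> A \<beta>. key G = k}" if k: "k \<in> key ` I" for k
  proof -
    obtain H where H: "H \<in> I" "k = key H" using k by blast
    \<comment> \<open>Agreement with \<open>H\<close> outside the region of \<open>H\<close> already
      forces equal regions, so membership in the group refers to one fixed region.\<close>
    have key_iff: "key G = k \<longleftrightarrow> G - ?L H = H - ?L H" for G
      unfolding H(2) key_def prod.inject using region_eqI[of G n j \<tau> H] by metis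
    have fibre: "{G \<in> A \<gamma>. key G = k} = {G. involution_graph {1..n} G \<and> G - ?L H = H - ?L H \<and>
        \<not> (\<exists>(a, b)\<in>?L H. occurs_within G j \<gamma> a b)}" for \<gamma>
    proof (intro set_eqI)
      fix G
      show "G \<in> {G \<in> A \<gamma>. key G = k} \<longleftrightarrow>
          G \<in> {G. involution_graph {1..n} G \<and> G - ?L H = H - ?L H \<and>
            \<not> (\<exists>(a, b)\<in>?L H. occurs_within G j \<gamma> a b)}"
      proof (cases "G - ?L H = H - ?L H")
        case True
        then have "?L G = ?L H" by (rule region_eqI)
        with True show ?thesis by (simp add: key_iff A_def I_def)
      qed (simp add: key_iff)
    qed
    have "involution_graph {1..n} H" using H(1) by (simp add: I_def)
    from card_fixed_outside_eq_num_symmetric_avoiding[OF this down_closed_region region_subset sym_region \<open>j > 0\<close>, of j \<tau> H]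
    obtain lam where "ferrers_shape lam" "self_conjugate lam"
      "\<And>\<gamma>. \<gamma> permutes {1..j} \<Longrightarrow>
        card {G \<in> A \<gamma>. key G = k} = num_symmetric_avoiding lam (one_line j \<gamma>)"
      unfolding fibre by blast
    then show ?thesis
      using shapes \<alpha> \<beta> by (simp add: involution_on_def)
  qed
  then have "card (A \<alpha>) = card (A \<beta>)"
    unfolding split by (intro sum.cong) auto
  then show ?thesis
    unfolding num_involutions_avoiding_eq_card_graphs[OF \<open>j > 0\<close> \<alpha> \<tau>]
      num_involutions_avoiding_eq_card_graphs[OF \<open>j > 0\<close> \<beta> \<tau>]
    by (simp add: A_def I_def)
qed

theorem corollary3p7:
  fixes j :: nat and \<alpha> \<beta> :: "nat \<Rightarrow> nat"
  assumes "involution_on j \<alpha>" and "involution_on j \<beta>"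
    and "\<And>lam. ferrers_shape lam \<Longrightarrow> self_conjugate lam \<Longrightarrow>
           num_symmetric_avoiding lam (one_line j \<alpha>) = num_symmetric_avoiding lam (one_line j \<beta>)"
  shows "prefixes_exchangeable j \<alpha> \<beta>"
  unfolding prefixes_exchangeable_def
proof (intro allI impI ballI)
  fix k n \<tau> assume \<tau>: "\<tau> \<in> permutations_of_set {j+1..k}"
  show "num_involutions_avoiding n (one_line j \<alpha> @ \<tau>) =
        num_involutions_avoiding n (one_line j \<beta> @ \<tau>)"
  proof (cases "j = 0")
    \<comment> \<open>Both prefixes are the empty word, so the two patterns coincide; a prefix copy
      has a corner only for \<open>j > 0\<close>.\<close>
    case True
    then show ?thesis by (simp add: one_line_def)
  next
    case False
    then show ?thesis
      using \<tau> by (intro num_involutions_avoiding_exchange assms) (auto simp: permutations_of_set_def)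
  qed
qed

end
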